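(* A vector of power demands $\tilde P_c\in\mathbb R^n$ is feasible (i.e., $\tilde P_c\in\mathcal F$) if $$\chi(\nu)^\top\,\mathbf{max}(\tilde P_c,\mathbf 0)\le\tfrac12\nu^\top V_L^*\qquad\text{for all }\nu\in\mathcal N_1 .$$
   Context: Notation: $[x]=\operatorname{diag}(x_1,\dots,x_k)$ for a vector $x$; $\mathbf 1,\mathbf 0$ are the all-ones and all-zeros vectors; vector and matrix inequalities are element-wise; $\mathbf{max}(a,b)$ is the element-wise maximum of $a,b\in\mathbb R^n$. Setting: a DC power grid with $n\ge1$ loads and $m\ge1$ sources. Its Kirchhoff matrix $Y=\begin{pmatrix} Y_{LL} & Y_{LS} \\ Y_{SL} & Y_{SS} \end{pmatrix}\in\mathbb R^{(n+m)\times(n+m)}$ is the weighted Laplacian of a connected undirected graph with positive edge weights (symmetric, nonpositive off-diagonal entries, zero row sums), partitioned according to loads and sources, and the $n\times n$ matrix $Y_{LL}$ is irreducible; hence $Y_{LL}$ is symmetric positive definite with nonpositive off-diagonal entries and has an entrywise positive inverse. The source voltages $V_S\in\mathbb R^m$, $V_S>\mathbf 0$, are fixed. Put $\mathcal I_L^*=-Y_{LS}V_S$ (which satisfies $\mathcal I_L^*\ge\mathbf 0$, $\mathcal I_L^*\ne\mathbf 0$) and $V_L^*=Y_{LL}^{-1}\mathcal I_L^*$ (which satisfies $V_L^*>\mathbf 0$). For $V_L\in\mathbb R^n$ put $P_c(V_L)=[V_L]Y_{LL}(V_L^*-V_L)$. The set of feasible power demands is $\mathcal F=\{P_c(V_L):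 V_L\in\mathbb R^n,\ V_L>\mathbf 0\}$. $\mathcal N=\{\nu\in\mathbb R^n:\nu\ge\mathbf 0\}$ and $\mathcal N_1=\{\nu\in\mathcal N:\mathbf 1^\top\nu=1\}$. For $\mu\in\mathbb R^n$ put $g(\mu)=[\mu]Y_{LL}+[Y_{LL}\mu]$, and $\psi(\mu)=g(\mu)^{-1}[\mu]\mathcal I_L^*$ when $g(\mu)$ is a nonsingular M-matrix (a matrix with nonpositive off-diagonal entries whose eigenvalues all have nonnegative real part). For nonzero $\nu\in\mathcal N$ the matrix $g(Y_{LL}^{-1}\nu)$ is a nonsingular M-matrix, and one puts $\chi(\nu)=[\psi(Y_{LL}^{-1}\nu)]^{-1}Y_{LL}^{-1}\nu$. *)

theory Defs
  imports "HOL-Analysis.Analysis"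
begin

text \<open>The order \<open><\<close> on \<open>real ^ 'n\<close> is not the element-wise strict order, so element-wise
  inequalities between vectors are written out componentwise.\<close>

definition diag :: "real ^ 'n \<Rightarrow> real ^ 'n ^ 'n" where
  "diag x = (\<chi> i j. if i = j then x $ i else 0)"

definition vmax :: "real ^ 'n \<Rightarrow> real ^ 'n \<Rightarrow> real ^ 'n" where
  "vmax a b = (\<chi> i. max (a $ i) (b $ i))"

text \<open>A weighted undirected graph on the vertex type \<open>'v\<close> is given by its weight function;
  \<open>i\<close> and \<open>j\<close> are joined by an edge iff \<open>w i j > 0\<close>.\<close>

definition weighted_graph :: "('v \<Rightarrow> 'v \<Rightarrow> real) \<Rightarrow> bool" where
  "weighted_graph w \<longleftrightarrow> (\<forall>i j. w i j = w j i) \<and> (\<forall>i j. w i j \<ge> 0) \<and> (\<forall>i. w i i = 0)"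

definition connected_graph :: "('v \<Rightarrow> 'v \<Rightarrow> real) \<Rightarrow> bool" where
  "connected_graph w \<longleftrightarrow> (\<forall>i j. (i, j) \<in> {(k, l). w k l > 0}\<^sup>*)"

definition laplacian :: "('v::finite \<Rightarrow> 'v \<Rightarrow> real) \<Rightarrow> real ^ 'v ^ 'v" where
  "laplacian w = (\<chi> i j. if i = j then (\<Sum>k\<in>UNIV. w i k) else - w i j)"

definition kirchhoff :: "real ^ 'v ^ 'v \<Rightarrow> bool" where
  "kirchhoff Y \<longleftrightarrow> (\<exists>w. weighted_graph w \<and> connected_graph w \<and> Y = laplacian w)"

text \<open>No simultaneous row and column permutation gives a block triangular form: \<open>S\<close> is the set of
  indices of one diagonal block. Every \<open>1 \<times> 1\<close> matrix is irreducible.\<close>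

definition irreducible_matrix :: "real ^ 'n ^ 'n \<Rightarrow> bool" where
  "irreducible_matrix A \<longleftrightarrow>
    \<not> (\<exists>S. S \<noteq> {} \<and> S \<noteq> UNIV \<and> (\<forall>i\<in>S. \<forall>j\<in>-S. A $ i $ j = 0))"

definition eigenvalue_of :: "real ^ 'n ^ 'n \<Rightarrow> complex \<Rightarrow> bool" where
  "eigenvalue_of A l \<longleftrightarrow>
    (\<exists>v :: complex ^ 'n. v \<noteq> 0 \<and> map_matrix complex_of_real A *v v = l *s v)"

definition M_matrix :: "real ^ 'n ^ 'n \<Rightarrow> bool" where
  "M_matrix A \<longleftrightarrow>
    (\<forall>i j. i \<noteq> j \<longrightarrow> A $ i $ j \<le> 0) \<and> (\<forall>l. eigenvalue_of A l \<longrightarrow> Re l \<ge> 0)"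

text \<open>Nodes are indexed by the sum type \<open>'n + 'm\<close>: loads are \<open>Inl i\<close>, sources are \<open>Inr k\<close>.\<close>

definition Y_LL :: "real ^ ('n::finite + 'm::finite) ^ ('n + 'm) \<Rightarrow> real ^ 'n ^ 'n" where
  "Y_LL Y = (\<chi> i j. Y $ Inl i $ Inl j)"

definition Y_LS :: "real ^ ('n::finite + 'm::finite) ^ ('n + 'm) \<Rightarrow> real ^ 'm ^ 'n" where
  "Y_LS Y = (\<chi> i k. Y $ Inl i $ Inr k)"

definition I_star :: "real ^ ('n::finite + 'm::finite) ^ ('n + 'm) \<Rightarrow> real ^ 'm \<Rightarrow> real ^ 'n" where
  "I_star Y V\<^sub>S = - (Y_LS Y *v V\<^sub>S)"

definition V_star :: "real ^ ('n::finite + 'm::finite) ^ ('n + 'm) \<Rightarrow> real ^ 'm \<Rightarrow> real ^ 'n" where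
  "V_star Y V\<^sub>S = matrix_inv (Y_LL Y) *v I_star Y V\<^sub>S"

definition P_c :: "real ^ ('n::finite + 'm::finite) ^ ('n + 'm) \<Rightarrow> real ^ 'm \<Rightarrow> real ^ 'n \<Rightarrow> real ^ 'n" where
  "P_c Y V\<^sub>S V = diag V *v (Y_LL Y *v (V_star Y V\<^sub>S - V))"

definition feasible_demands :: "real ^ ('n::finite + 'm::finite) ^ ('n + 'm) \<Rightarrow> real ^ 'm \<Rightarrow> (real ^ 'n) set" where
  "feasible_demands Y V\<^sub>S = {P_c Y V\<^sub>S V |V. \<forall>i. V $ i > 0}"

definition N_set :: "(real ^ 'n) set" where
  "N_set = {\<nu>. \<forall>i. \<nu> $ i \<ge> 0}"

definition N1_set :: "(real ^ 'n) set" where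
  "N1_set = {\<nu> \<in> N_set. (\<Sum>i\<in>UNIV. \<nu> $ i) = 1}"

definition g_mat :: "real ^ ('n::finite + 'm::finite) ^ ('n + 'm) \<Rightarrow> real ^ 'n \<Rightarrow> real ^ 'n ^ 'n" where
  "g_mat Y \<mu> = diag \<mu> ** Y_LL Y + diag (Y_LL Y *v \<mu>)"

definition \<psi> :: "real ^ ('n::finite + 'm::finite) ^ ('n + 'm) \<Rightarrow> real ^ 'm \<Rightarrow> real ^ 'n \<Rightarrow> real ^ 'n" where
  "\<psi> Y V\<^sub>S \<mu> =
    (if invertible (g_mat Y \<mu>) \<and> M_matrix (g_mat Y \<mu>)
     then matrix_inv (g_mat Y \<mu>) *v (diag \<mu> *v I_star Y V\<^sub>S) else undefined)"

definition \<chi>_fun :: "real ^ ('n::finite + 'm::finite) ^ ('n + 'm) \<Rightarrow> real ^ 'm \<Rightarrow> real ^ 'n \<Rightarrow> real ^ 'n" where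
  "\<chi>_fun Y V\<^sub>S \<nu> =
    matrix_inv (diag (\<psi> Y V\<^sub>S (matrix_inv (Y_LL Y) *v \<nu>))) *v (matrix_inv (Y_LL Y) *v \<nu>)"

end

theory Submission
  imports Defs
begin

text \<open>Put \<open>Q = max(P, 0)\<close>, \<open>A = Y\<^sub>L\<^sub>L\<close>, and call a demand \<open>R\<close> dominated if some \<open>V \<ge> 0\<close>
  satisfies \<open>P\<^sub>c(V) \<ge> R\<close>. If \<open>Q\<close> is dominated, the subsolution can be made positive, and
  monotonicity turns a largest subsolution for \<open>P\<close> into a solution. The dominated demands form a convex set, since \<open>P\<^sub>c\<close>
  is concave in the squared voltages. If \<open>Q\<close> is not dominated, take the last dominated point \<open>t Q\<close>
  with \<open>t < 1\<close>, a voltage \<open>V\<close> attaining it, and a normal vector \<open>a\<close> of a supporting hyperplane there.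
  Irreducibility gives \<open>a > 0\<close> and \<open>V > 0\<close>, and stationarity of \<open>a \<bullet> P\<^sub>c\<close> at \<open>V\<close> reads
  \<open>A [a] V = [a] (I\<^sup>* - A V)\<close>. Up to scaling of \<open>a\<close>, this says \<open>\<psi>([a] V) = V\<close> and \<open>\<chi>(\<nu>) = a\<close> for
  \<open>\<nu> = A [a] V\<close>, and \<open>a \<bullet> Q > a \<bullet> P\<^sub>c(V) = \<nu> \<bullet> V\<^sup>* / 2\<close> contradicts the hypothesis.\<close>

section \<open>Linear algebra and calculus preliminaries\<close>

lemma matrix_vector_component: "(A *v x) $ i = (\<Sum>j\<in>UNIV. A $ i $ j * x $ j)"
  by (simp add: matrix_vector_mult_def)

lemma diag_mult_component [simp]: "(diag x *v y) $ i = x $ i * y $ i"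
proof -
  have "(diag x *v y) $ i = (\<Sum>j\<in>UNIV. if i = j then x $ i * y $ j else 0)"
    unfolding matrix_vector_component by (rule sum.cong) (auto simp: diag_def)
  then show ?thesis by simp
qed

lemma matrix_inv_cancel:
  assumes "invertible A"
  shows "A ** matrix_inv A = mat 1" "matrix_inv A ** A = mat 1"
  using someI_ex[OF assms[unfolded invertible_def]] by (auto simp: matrix_inv_def)

lemma matrix_inv_mult_eq:
  fixes A :: "real ^ 'n ^ 'n"
  assumes "invertible A" "A *v x = y"
  shows "matrix_inv A *v y = x"
  using assms
  by (metis matrix_inv_cancel(2) matrix_vector_mul_assoc matrix_vector_mul_lid)

lemma invertible_if_trivial_kernel:
  fixes A :: "real ^ 'n ^ 'n"
  assumes "\<And>x. A *v x = 0 \<Longrightarrow> x = 0"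
  shows "invertible A"
  using assms invertible_left_inverse matrix_left_invertible_ker by blast

text \<open>First-order condition for one-sided variations: divide by \<open>s\<close> and let
  \<open>s\<close> tend to 0 from the right.\<close>

lemma quadratic_nonpos_imp_linear_coeff_nonpos:
  fixes d c \<delta> :: real
  assumes "0 < \<delta>" and le: "\<And>s. 0 < s \<Longrightarrow> s < \<delta> \<Longrightarrow> s * d - s * s * c \<le> 0"
  shows "d \<le> 0"
proof -
  have "((\<lambda>s. d - s * c) \<longlongrightarrow> d - 0 * c) (at_right 0)"
    by (intro tendsto_intros)
  moreover have "\<forall>\<^sub>F s in at_right 0. d - s * c \<le> 0"
    unfolding eventually_at_right_field
  proof (intro exI conjI allI impI)
    show "0 < \<delta>" by fact
    fix s :: real assume s: "0 < s" "s < \<delta>"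
    have "s * (d - s * c) \<le> 0" using le[OF s] by (simp add: algebra_simps)
    then show "d - s * c \<le> 0" using s(1) by (simp add: mult_le_0_iff)
  qed
  ultimately show ?thesis
    using tendsto_upperbound[of "\<lambda>s. d - s * c" "d - 0 * c" "at_right 0" 0] by simp
qed

section \<open>Comparison principles for an irreducible Stieltjes matrix\<close>

text \<open>What the argument uses of the grid, with \<open>A\<close> for \<open>Y_LL Y\<close> and
  \<open>c\<close> for \<open>I_star Y V\<^sub>S\<close>; the Kirchhoff structure enters only
  through \<open>power_grid_Y_LL\<close>.\<close>

locale power_grid =
  fixes A :: "real ^ 'n ^ 'n" and c :: "real ^ 'n"
  assumes sym: "A $ i $ j = A $ j $ i"
    and offdiag: "i \<noteq> j \<Longrightarrow> A $ i $ j \<le> 0"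
    and posdef: "x \<noteq> 0 \<Longrightarrow> 0 < x \<bullet> (A *v x)"
    and irred: "irreducible_matrix A"
    and c_nonneg: "0 \<le> c $ i"
    and c_nonzero: "c \<noteq> 0"
begin

text \<open>A component of \<open>P_c\<close>, free of inverses because \<open>A\<close> maps the
  open-circuit voltage to \<open>c\<close>.\<close>

definition load_power :: "real ^ 'n \<Rightarrow> 'n \<Rightarrow> real" where
  "load_power x i = x $ i * (c $ i - (A *v x) $ i)"

lemma possemidef: "0 \<le> x \<bullet> (A *v x)"
  using posdef[of x] by (cases "x = 0") auto

lemma invertible_A: "invertible A"
  by (rule invertible_if_trivial_kernel) (metis inner_zero_right less_irrefl posdef)

lemma adjoint: "x \<bullet> (A *v y) = (A *v x) \<bullet> y"
proof -
  have "transpose A = A" by (simp add: transpose_def vec_eq_iff sym)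
  then show ?thesis by (metis dot_lmul_matrix vector_transpose_matrix)
qed

text \<open>The diagonal terms agree, and the nonpositive off-diagonal entries reverse the
  inequality.\<close>

lemma mult_antimono:
  assumes "\<And>j. y $ j \<le> x $ j" "x $ i = y $ i"
  shows "(A *v x) $ i \<le> (A *v y) $ i"
  unfolding matrix_vector_component
proof (rule sum_mono)
  fix j
  show "A $ i $ j * x $ j \<le> A $ i $ j * y $ j"
    using assms offdiag[of i j] by (cases "i = j") (auto intro: mult_left_mono_neg)
qed

lemma mult_nonpos:
  assumes "\<And>j. 0 \<le> x $ j" "x $ i = 0"
  shows "(A *v x) $ i \<le> 0"
  using mult_antimono[of 0 x i] assms by simp

text \<open>Test the positive definite form against the negative part of \<open>x\<close>.\<close>

lemma inverse_nonneg:
  assumes "\<And>i. 0 \<le> (A *v x) $ i"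
  shows "0 \<le> x $ i"
proof -
  define y :: "real ^ 'n" where "y = (\<chi> i. max (- (x $ i)) 0)"
  define p :: "real ^ 'n" where "p = (\<chi> i. max (x $ i) 0)"
  have x: "x = p - y" by (simp add: p_def y_def vec_eq_iff max_def)
  have "y \<bullet> (A *v p) \<le> 0"
    unfolding inner_vec_def
  proof (rule sum_nonpos)
    fix i
    have "0 < y $ i \<Longrightarrow> p $ i = 0" "0 \<le> y $ i" by (auto simp: y_def p_def max_def split: if_splits)
    then show "y $ i \<bullet> (A *v p) $ i \<le> 0"
      using mult_nonpos[of p i]
      by (cases "y $ i = 0") (auto simp: p_def mult_le_0_iff)
  qed
  moreover have "0 \<le> y \<bullet> (A *v x)"
    unfolding inner_vec_def by (rule sum_nonneg) (simp add: assms y_def)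
  ultimately have "y \<bullet> (A *v y) \<le> 0"
    unfolding x by (simp add: matrix_vector_mult_diff_distrib inner_diff_right)
  then have "y = 0" using posdef[of y] by force
  then have "y $ i = 0" by simp
  then show ?thesis by (simp add: y_def max_def split: if_splits)
qed

lemma mult_le_imp_le:
  assumes "\<And>i. (A *v x) $ i \<le> (A *v y) $ i"
  shows "x $ i \<le> y $ i"
  using inverse_nonneg[of "y - x" i] assms by (simp add: matrix_vector_mult_diff_distrib)

text \<open>If \<open>P\<close> held only on a proper subset, irreducibility would supply a nonzero
  entry leading out of it.\<close>

lemma irreducible_induct:
  assumes "P i0" and step: "\<And>i j. P i \<Longrightarrow> A $ i $ j \<noteq> 0 \<Longrightarrow> P j"
  shows "P i"
proof -
  have "{i. P i} = UNIV"
    using irred assms(1) unfolding irreducible_matrix_def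
    by (metis (mono_tags, lifting) ComplD empty_iff mem_Collect_eq step)
  then show ?thesis by auto
qed

text \<open>With \<open>x $ i = 0\<close> every term of row \<open>i\<close> is nonpositive, so a
  nonnegative sum makes each term vanish. Spread by \<open>irreducible_induct\<close>, this is the
  strong maximum principle.\<close>

lemma sum_neighbours_zero:
  assumes "\<And>j. 0 \<le> x $ j" "x $ i = 0" "0 \<le> (A *v x) $ i" "A $ i $ j \<noteq> 0"
  shows "x $ j = 0"
proof -
  have "A $ i $ k * x $ k \<le> 0" for k
    using assms(1)[of k] assms(2) offdiag[of i k] by (cases "i = k") (auto simp: mult_le_0_iff)
  moreover have "0 \<le> (\<Sum>k\<in>UNIV. A $ i $ k * x $ k)"
    using assms(3) by (simp add: matrix_vector_component)
  ultimately have "A $ i $ j * x $ j = 0"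
    using sum_nonneg_0[of UNIV "\<lambda>k. - (A $ i $ k * x $ k)" j]
      sum_nonpos[of UNIV "\<lambda>k. A $ i $ k * x $ k"]
    by (simp add: sum_negf)
  then show ?thesis using assms(4) by simp
qed

lemma inverse_pos:
  assumes nonneg: "\<And>i. 0 \<le> (A *v x) $ i" and "x \<noteq> 0"
  shows "0 < x $ i"
proof (rule ccontr)
  assume "\<not> 0 < x $ i"
  then have "x $ i = 0" using inverse_nonneg[OF nonneg, of i] by simp
  then have "x $ j = 0" for j
    by (rule irreducible_induct[where P = "\<lambda>i. x $ i = 0"])
      (metis inverse_nonneg nonneg sum_neighbours_zero)
  then show False using \<open>x \<noteq> 0\<close> by (simp add: vec_eq_iff)
qed

section \<open>Open-circuit voltage and monotone solvability\<close>

definition Vopen :: "real ^ 'n" where "Vopen = matrix_inv A *v c"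

lemma mult_Vopen: "A *v Vopen = c"
  unfolding Vopen_def
  by (simp add: invertible_A matrix_inv_cancel(1) matrix_vector_mul_assoc)

lemma Vopen_pos: "0 < Vopen $ i"
proof (rule inverse_pos)
  show "Vopen \<noteq> 0" using mult_Vopen c_nonzero by (metis matrix_vector_mult_0_right)
qed (simp add: mult_Vopen c_nonneg)

lemma continuous_mult [continuous_intros]:
  "continuous_on S f \<Longrightarrow> continuous_on S (\<lambda>x. A *v (f x))"
  unfolding matrix_vector_mult_def by (intro continuous_intros)

lemma continuous_load_power [continuous_intros]:
  "continuous_on S f \<Longrightarrow> continuous_on S (\<lambda>x. load_power (f x) i)"
  unfolding load_power_def by (intro continuous_intros)

lemma mult_add_axis: "(A *v (x + s *s axis i 1)) $ j = (A *v x) $ j + s * A $ j $ i"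
  by (simp add: matrix_vector_right_distrib vector_scalar_commute matrix_vector_mult_basis
      column_def)

text \<open>The system is quasi-monotone: raising one voltage raises the power available at the other
  loads. So a subsolution of maximal total voltage is a solution.\<close>

lemma solution_above_subsolution:
  assumes V0: "\<And>i. 0 < V0 $ i" and sub: "\<And>i. p $ i \<le> load_power V0 i"
  obtains V where "\<And>i. 0 < V $ i" "\<And>i. load_power V i = p $ i"
proof -
  define K where "K = {V. (\<forall>i. V0 $ i \<le> V $ i) \<and> (\<forall>i. p $ i \<le> load_power V i)}"
  \<comment> \<open>Dividing the power inequality by \<open>V $ i\<close>, which is at least
    \<open>V0 $ i\<close>, bounds \<open>A *v V\<close> by \<open>J\<close>; inverse positivity then
    bounds \<open>K\<close>.\<close>
  define J :: "real ^ 'n" where "J = (\<chi> i. c $ i + \<bar>p $ i\<bar> / V0 $ i)"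
  define B where "B = matrix_inv A *v J"
  have AB: "A *v B = J"
    unfolding B_def by (simp add: invertible_A matrix_inv_cancel(1) matrix_vector_mul_assoc)
  have "K \<subseteq> {V0..B}"
  proof
    fix V assume V: "V \<in> K"
    have "(A *v V) $ i \<le> (A *v B) $ i" for i
    proof -
      have v: "V0 $ i \<le> V $ i" "p $ i \<le> V $ i * (c $ i - (A *v V) $ i)"
        using V by (auto simp: K_def load_power_def)
      have vpos: "0 < V $ i" using V0[of i] v by linarith
      have "- \<bar>p $ i\<bar> / V0 $ i \<le> - \<bar>p $ i\<bar> / V $ i"
        using v V0[of i] vpos by (simp add: frac_le)
      also have "\<dots> \<le> p $ i / V $ i" using vpos by (intro divide_right_mono) auto
      also have "\<dots> \<le> c $ i - (A *v V) $ i" using v vpos by (simp add: field_simps)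
      finally show ?thesis by (simp add: AB J_def)
    qed
    then have "V $ i \<le> B $ i" for i by (rule mult_le_imp_le)
    then show "V \<in> {V0..B}" using V by (auto simp: K_def less_eq_vec_def)
  qed
  moreover have "closed K"
    unfolding K_def Collect_conj_eq
    by (intro closed_Int closed_Collect_all closed_Collect_le continuous_intros)
  moreover have "bounded {V0..B}" by (simp add: interval_cbox[symmetric])
  ultimately have "compact K" using bounded_subset compact_eq_bounded_closed by blast
  moreover have "V0 \<in> K" using sub by (simp add: K_def)
  moreover have "continuous_on K (\<lambda>V. \<Sum>i\<in>UNIV. V $ i)" by (intro continuous_intros)
  ultimately obtain V where V: "V \<in> K" and
    max: "\<And>W. W \<in> K \<Longrightarrow> (\<Sum>i\<in>UNIV. W $ i) \<le> (\<Sum>i\<in>UNIV. V $ i)"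
    using continuous_attains_sup[of K "\<lambda>V. \<Sum>i\<in>UNIV. V $ i"] by blast
  have vpos: "0 < V $ i" for i using V V0[of i] by (auto simp: K_def intro: less_le_trans)
  have "load_power V i = p $ i" for i
  proof (rule ccontr)
    assume "load_power V i \<noteq> p $ i"
    moreover have "p $ i \<le> load_power V i" using V by (simp add: K_def)
    ultimately have gt: "p $ i < load_power V i" by simp
    \<comment> \<open>By continuity the strict slack at load \<open>i\<close> survives a small rise
      of its own voltage.\<close>
    have "continuous_on UNIV (\<lambda>s. load_power (V + s *s axis i 1) i)"
      unfolding scalar_mult_eq_scaleR by (intro continuous_intros)
    then have "isCont (\<lambda>s. load_power (V + s *s axis i 1) i) 0"
      by (simp add: continuous_on_eq_continuous_at)
    then have "((\<lambda>s. load_power (V + s *s axis i 1) i) \<longlongrightarrow> load_power V i) (at_right 0)"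
      unfolding isCont_def by (auto intro: tendsto_within_subset)
    then have "\<forall>\<^sub>F s in at_right 0. p $ i < load_power (V + s *s axis i 1) i"
      using gt by (rule order_tendstoD)
    then obtain b where b: "0 < b" "\<And>s. 0 < s \<Longrightarrow> s < b \<Longrightarrow> p $ i < load_power (V + s *s axis i 1) i"
      unfolding eventually_at_right_field by auto
    define s where "s = b / 2"
    have s: "0 < s" "p $ i < load_power (V + s *s axis i 1) i"
      using b(1) b(2)[of s] by (auto simp: s_def)
    define W where "W = V + s *s axis i 1"
    have W: "W $ j = (if j = i then V $ j + s else V $ j)" for j
      by (auto simp: W_def axis_def)
    have "p $ j \<le> load_power W j" for j
    proof (cases "j = i")
      case True then show ?thesis using s by (simp add: W_def)
    next
      case False
      have "(A *v W) $ j \<le> (A *v V) $ j"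
        using s False by (intro mult_antimono) (auto simp: W)
      then have "load_power V j \<le> load_power W j"
        using vpos[of j] False by (simp add: load_power_def W)
      moreover have "p $ j \<le> load_power V j" using V by (simp add: K_def)
      ultimately show ?thesis by simp
    qed
    then have "W \<in> K" using V s by (auto simp: K_def W intro: order_trans less_imp_le)
    moreover have "(\<Sum>j\<in>UNIV. V $ j) < (\<Sum>j\<in>UNIV. W $ j)"
      using s by (intro sum_strict_mono_ex1) (auto simp: W)
    ultimately show False using max by force
  qed
  then show thesis using that vpos by blast
qed

text \<open>Where \<open>V\<close> vanishes, so does \<open>Q\<close>, and nonnegative power
  suffices there. Lifting these voltages to a small multiple of \<open>Vopen\<close> provides it,
  and does not lower the power at the loads whose voltage stays fixed.\<close>

lemma make_subsolution_positive:
  assumes V: "\<And>i. 0 \<le> V $ i" and Q: "\<And>i. 0 \<le> Q $ i" and sub: "\<And>i. Q $ i \<le> load_power V i"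
  obtains W where "\<And>i. 0 < W $ i" "\<And>i. Q $ i \<le> load_power W i"
proof -
  obtain e where e: "0 < e" "e \<le> 1" "\<And>i. 0 < V $ i \<Longrightarrow> e * Vopen $ i \<le> V $ i"
  proof -
    \<comment> \<open>The inserted 1 keeps the set nonempty and gives \<open>e \<le> 1\<close>, so
      that \<open>e * c $ i \<le> c $ i\<close> below.\<close>
    define e where "e = Min (insert 1 ((\<lambda>i. V $ i / Vopen $ i) ` {i. 0 < V $ i}))"
    have "e * Vopen $ i \<le> V $ i" if "0 < V $ i" for i
    proof -
      have "e \<le> V $ i / Vopen $ i" unfolding e_def using that by (intro Min_le) auto
      then show ?thesis using Vopen_pos[of i] by (simp add: field_simps)
    qed
    moreover have "0 < e" unfolding e_def using Vopen_pos by (subst Min_gr_iff) auto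
    moreover have "e \<le> 1" unfolding e_def by (intro Min_le) auto
    ultimately show thesis using that by blast
  qed
  define W :: "real ^ 'n" where "W = (\<chi> i. max (V $ i) (e * Vopen $ i))"
  have eV: "0 < e * Vopen $ i" for i using e(1) Vopen_pos[of i] by simp
  have Wpos: "0 < W $ i" for i using eV[of i] by (simp add: W_def less_max_iff_disj)
  have "Q $ i \<le> load_power W i" for i
  proof (cases "0 < V $ i")
    case True
    then have Wi: "W $ i = V $ i" using e(3)[OF True] by (simp add: W_def)
    have "(A *v W) $ i \<le> (A *v V) $ i"
      by (rule mult_antimono) (simp_all add: Wi, simp add: W_def)
    then have "load_power V i \<le> load_power W i" using True by (simp add: load_power_def Wi)
    then show ?thesis using sub[of i] by simp
  next
    case False
    then have v: "V $ i = 0" using V[of i] by simp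
    then have q: "Q $ i = 0" using Q[of i] sub[of i] by (simp add: load_power_def)
    have "(A *v W) $ i \<le> (A *v (e *s Vopen)) $ i"
      by (rule mult_antimono) (use eV[of i] in \<open>auto simp: W_def v\<close>)
    also have "\<dots> = e * c $ i"
      by (simp add: vector_scalar_commute mult_Vopen)
    also have "\<dots> \<le> c $ i" using e c_nonneg[of i] by (simp add: mult_left_le_one_le)
    finally show ?thesis using Wpos[of i] by (simp add: load_power_def q)
  qed
  then show thesis using that Wpos by blast
qed

section \<open>The convex set of dominated demands\<close>

text \<open>The weak inequalities are closed conditions, for compactness arguments; asking only for
  a lower bound on power makes the set closed downwards, so that supporting normals are
  nonnegative.\<close>

definition dominated :: "(real ^ 'n) set" where
  "dominated = {R. \<exists>V. (\<forall>i. 0 \<le> V $ i) \<and> (\<forall>i. R $ i \<le> load_power V i)}"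

text \<open>In the squared voltages the power is a concave function, because geometric means are concave
  and the off-diagonal entries of \<open>A\<close> are nonpositive.\<close>

lemma convex_dominated: "convex dominated"
proof (rule convexI)
  fix R S :: "real ^ 'n" and u v :: real
  assume "R \<in> dominated" "S \<in> dominated" and uv: "0 \<le> u" "0 \<le> v" "u + v = 1"
  then obtain x y where x: "\<And>i. 0 \<le> x $ i" "\<And>i. R $ i \<le> load_power x i"
    and y: "\<And>i. 0 \<le> y $ i" "\<And>i. S $ i \<le> load_power y i"
    unfolding dominated_def by blast
  \<comment> \<open>Linear interpolation of the squared voltages.\<close>
  define z :: "real ^ 'n" where "z = (\<chi> i. sqrt (u * (x $ i)\<^sup>2 + v * (y $ i)\<^sup>2))"
  have z0: "0 \<le> z $ i" for i using uv by (simp add: z_def)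
  have zsq: "z $ i * z $ i = u * (x $ i * x $ i) + v * (y $ i * y $ i)" for i
    using uv by (simp add: z_def power2_eq_square)
  \<comment> \<open>Cauchy-Schwarz for the weights \<open>u\<close> and \<open>v\<close>.\<close>
  have prod: "u * (x $ i * x $ j) + v * (y $ i * y $ j) \<le> z $ i * z $ j" for i j
  proof (rule power2_le_imp_le)
    have "(z $ i * z $ j)\<^sup>2 - (u * (x $ i * x $ j) + v * (y $ i * y $ j))\<^sup>2
        = (z $ i * z $ i) * (z $ j * z $ j) - (u * (x $ i * x $ j) + v * (y $ i * y $ j))\<^sup>2"
      by (simp add: power2_eq_square algebra_simps)
    also have "\<dots> = u * v * (x $ i * y $ j - x $ j * y $ i)\<^sup>2"
      unfolding zsq by (simp add: power2_eq_square algebra_simps)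
    also have "\<dots> \<ge> 0" using uv by simp
    finally show "(u * (x $ i * x $ j) + v * (y $ i * y $ j))\<^sup>2 \<le> (z $ i * z $ j)\<^sup>2" by simp
    show "0 \<le> z $ i * z $ j" using z0 by simp
  qed
  \<comment> \<open>The quadratic mean dominates the arithmetic mean.\<close>
  have lin: "u * x $ i + v * y $ i \<le> z $ i" for i
  proof (rule power2_le_imp_le)
    have "(z $ i)\<^sup>2 - (u * x $ i + v * y $ i)\<^sup>2
       = (u + v) * (u * (x $ i * x $ i) + v * (y $ i * y $ i)) - (u * x $ i + v * y $ i)\<^sup>2"
      using zsq[of i] uv by (simp add: power2_eq_square)
    also have "\<dots> = u * v * (x $ i - y $ i)\<^sup>2"
      by (simp add: power2_eq_square algebra_simps)
    also have "\<dots> \<ge> 0" using uv by simp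
    finally show "(u * x $ i + v * y $ i)\<^sup>2 \<le> (z $ i)\<^sup>2" by simp
  qed (rule z0)
  have "(u *\<^sub>R R + v *\<^sub>R S) $ i \<le> load_power z i" for i
  proof -
    have "(u *\<^sub>R R + v *\<^sub>R S) $ i \<le> u * load_power x i + v * load_power y i"
      using x(2)[of i] y(2)[of i] uv by (simp add: add_mono mult_left_mono)
    also have "\<dots> = (u * x $ i + v * y $ i) * c $ i
        - (\<Sum>j\<in>UNIV. A $ i $ j * (u * (x $ i * x $ j) + v * (y $ i * y $ j)))"
      unfolding load_power_def matrix_vector_component
      by (simp add: algebra_simps sum.distrib sum_distrib_left)
    also have "\<dots> \<le> z $ i * c $ i - (\<Sum>j\<in>UNIV. A $ i $ j * (z $ i * z $ j))"
    proof (rule diff_mono)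
      show "(u * x $ i + v * y $ i) * c $ i \<le> z $ i * c $ i"
        using lin c_nonneg by (intro mult_right_mono)
      show "(\<Sum>j\<in>UNIV. A $ i $ j * (z $ i * z $ j))
          \<le> (\<Sum>j\<in>UNIV. A $ i $ j * (u * (x $ i * x $ j) + v * (y $ i * y $ j)))"
      proof (rule sum_mono)
        fix j
        show "A $ i $ j * (z $ i * z $ j)
            \<le> A $ i $ j * (u * (x $ i * x $ j) + v * (y $ i * y $ j))"
          \<comment> \<open>On the diagonal both sides agree by \<open>zsq\<close>; elsewhere
            \<open>prod\<close> is multiplied by a nonpositive entry.\<close>
          using prod[of i j] zsq[of i] offdiag[of i j]
          by (cases "i = j") (auto intro: mult_left_mono_neg)
      qed
    qed
    also have "\<dots> = load_power z i"
      unfolding load_power_def matrix_vector_component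
      by (simp add: algebra_simps sum_distrib_left)
    finally show ?thesis .
  qed
  then show "u *\<^sub>R R + v *\<^sub>R S \<in> dominated"
    unfolding dominated_def using z0 by blast
qed

text \<open>Nonnegative power forces \<open>A *v V \<le> c\<close> componentwise: divide by
  \<open>V $ i\<close> if it is positive, otherwise the row value is nonpositive. This is the bound
  that makes the ray problem compact.\<close>

lemma subsolution_le_Vopen:
  assumes "\<And>i. 0 \<le> V $ i" "\<And>i. 0 \<le> load_power V i"
  shows "V $ i \<le> Vopen $ i"
proof (rule mult_le_imp_le)
  fix i
  show "(A *v V) $ i \<le> (A *v Vopen) $ i"
  proof (cases "V $ i = 0")
    case True
    then show ?thesis
      using mult_nonpos[of V i] assms(1) c_nonneg[of i] by (simp add: mult_Vopen)
  next
    case False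
    then have "0 < V $ i" using assms(1)[of i] by simp
    then show ?thesis
      using assms(2)[of i] by (simp add: load_power_def mult_Vopen zero_le_mult_iff)
  qed
qed

lemma dominated_ray_max:
  assumes Q: "\<And>i. 0 \<le> Q $ i"
  obtains t V where "0 \<le> t" "t \<le> 1" "\<And>i. 0 \<le> V $ i" "\<And>i. t * Q $ i \<le> load_power V i"
    "\<And>s. t < s \<Longrightarrow> s \<le> 1 \<Longrightarrow> s *\<^sub>R Q \<notin> dominated"
proof -
  define K where "K = {z :: real \<times> (real ^ 'n). 0 \<le> fst z \<and> fst z \<le> 1 \<and> (\<forall>i. 0 \<le> snd z $ i)
    \<and> (\<forall>i. fst z * Q $ i \<le> load_power (snd z) i)}"
  have "K \<subseteq> {0..1} \<times> {0..Vopen}"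
  proof
    fix z assume z: "z \<in> K"
    then have "0 \<le> fst z * Q $ i" for i using Q by (simp add: K_def)
    then have "0 \<le> load_power (snd z) i" for i
      using z unfolding K_def by (blast intro: order_trans)
    then have "snd z $ i \<le> Vopen $ i" for i
      using z by (intro subsolution_le_Vopen) (auto simp: K_def)
    then show "z \<in> {0..1} \<times> {0..Vopen}"
      using z by (cases z) (auto simp: K_def less_eq_vec_def)
  qed
  moreover have "bounded ({0..1::real} \<times> {0..Vopen})"
    by (intro bounded_Times) (simp_all add: interval_cbox[symmetric])
  moreover have "closed K"
    unfolding K_def Collect_conj_eq
    by (intro closed_Int closed_Collect_all closed_Collect_le continuous_intros)
  ultimately have "compact K" using bounded_subset compact_eq_bounded_closed by blast
  moreover have "(0, 0) \<in> K" by (simp add: K_def load_power_def)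
  moreover have "continuous_on K fst" by (intro continuous_intros)
  ultimately obtain z where z: "z \<in> K" and max: "\<And>y. y \<in> K \<Longrightarrow> fst y \<le> fst z"
    using continuous_attains_sup[of K fst] by blast
  show thesis
  proof (rule that[of "fst z" "snd z"])
    fix s assume s: "fst z < s" "s \<le> 1"
    show "s *\<^sub>R Q \<notin> dominated"
    proof
      assume "s *\<^sub>R Q \<in> dominated"
      then obtain V where "\<forall>i. 0 \<le> V $ i" "\<forall>i. s * Q $ i \<le> load_power V i"
        by (auto simp: dominated_def)
      then have "(s, V) \<in> K" using s z by (auto simp: K_def)
      then show False using max[of "(s, V)"] s by simp
    qed
  qed (use z in \<open>auto simp: K_def\<close>)
qed

section \<open>First-order conditions for maximal weighted power\<close>

text \<open>The partial derivative in \<open>V $ i\<close> of the power weighted by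
  \<open>a\<close>.\<close>

definition grad :: "real ^ 'n \<Rightarrow> real ^ 'n \<Rightarrow> 'n \<Rightarrow> real" where
  "grad a V i = a $ i * (c $ i - (A *v V) $ i) - (A *v (diag a *v V)) $ i"

lemma weighted_power_add_axis:
  "(\<Sum>j\<in>UNIV. a $ j * load_power (V + s *s axis i 1) j)
    = (\<Sum>j\<in>UNIV. a $ j * load_power V j) + s * grad a V i - s * s * (a $ i * A $ i $ i)"
proof -
  have "a $ j * load_power (V + s *s axis i 1) j = a $ j * load_power V j
      - s * (A $ i $ j * (a $ j * V $ j))
      + (if j = i then s * (a $ i * (c $ i - (A *v V) $ i - s * A $ i $ i)) else 0)" for j
    unfolding load_power_def mult_add_axis
    by (simp add: sym[of i j] axis_def algebra_simps)
  then have "(\<Sum>j\<in>UNIV. a $ j * load_power (V + s *s axis i 1) j) = (\<Sum>j\<in>UNIV. a $ j * load_power V j)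
      - s * (A *v (diag a *v V)) $ i + s * (a $ i * (c $ i - (A *v V) $ i - s * A $ i $ i))"
    by (simp add: sum.distrib sum_subtractf sum_distrib_left matrix_vector_component[of A])
  then show ?thesis by (simp add: grad_def algebra_simps)
qed

context
  fixes a V :: "real ^ 'n"
  assumes a_nonneg: "\<And>i. 0 \<le> a $ i" and a_nonzero: "a \<noteq> 0"
    and V_nonneg: "\<And>i. 0 \<le> V $ i"
    and maximal: "\<And>W. (\<And>i. 0 \<le> W $ i) \<Longrightarrow>
      (\<Sum>i\<in>UNIV. a $ i * load_power W i) \<le> (\<Sum>i\<in>UNIV. a $ i * load_power V i)"
begin

text \<open>If \<open>a\<close> vanishes at \<open>i\<close> but not at its neighbour \<open>j\<close>, raising the voltage of \<open>i\<close> makes the weighted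
  power grow without bound.\<close>

lemma maximal_weight_pos: "0 < a $ i"
proof (rule ccontr)
  assume "\<not> 0 < a $ i"
  then have "a $ i = 0" using a_nonneg[of i] by simp
  then have "a $ j = 0" for j
  proof (rule irreducible_induct[where P = "\<lambda>i. a $ i = 0"])
    fix i j assume ai: "a $ i = 0" and Aij: "A $ i $ j \<noteq> 0"
    show "a $ j = 0"
    proof (rule ccontr)
      assume "a $ j \<noteq> 0"
      then have aj: "0 < a $ j" and ij: "i \<noteq> j" using a_nonneg[of j] ai by auto
      define W where "W = axis j (1::real)"
      have W: "diag a *v W = a $ j *s W" by (auto simp: vec_eq_iff W_def axis_def)
      have g: "grad a W i = a $ j * - (A $ i $ j)"
        by (simp add: grad_def ai W vector_scalar_commute)
           (simp add: W_def matrix_vector_mult_basis column_def)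
      have gpos: "0 < grad a W i"
        unfolding g using aj Aij offdiag[OF ij] by (intro mult_pos_pos) auto
      define B where "B = (\<Sum>i\<in>UNIV. a $ i * load_power V i) - (\<Sum>i\<in>UNIV. a $ i * load_power W i)"
      \<comment> \<open>Since \<open>a $ i = 0\<close>, the quadratic coefficient vanishes and the
        growth is exactly linear in \<open>s\<close>.\<close>
      have "s * grad a W i \<le> B" if "0 \<le> s" for s
        using maximal[of "W + s *s axis i 1"] that
        unfolding weighted_power_add_axis B_def by (simp add: ai W_def axis_def)
      from this[of "(\<bar>B\<bar> + 1) / grad a W i"] gpos show False by simp
    qed
  qed
  then show False using a_nonzero by (simp add: vec_eq_iff)
qed

text \<open>Raising a voltage never leaves the nonnegative orthant; lowering it is admissible only
  once \<open>V\<close> is known to be positive.\<close>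

lemma maximal_grad_nonpos: "grad a V i \<le> 0"
proof (rule quadratic_nonpos_imp_linear_coeff_nonpos[where \<delta> = 1])
  fix s :: real assume "0 < s"
  then show "s * grad a V i - s * s * (a $ i * A $ i $ i) \<le> 0"
    using maximal[of "V + s *s axis i 1"] V_nonneg
    unfolding weighted_power_add_axis by (simp add: axis_def)
qed simp

text \<open>At a zero of \<open>V\<close> the gradient bound and the row signs force both
  \<open>(A *v V) $ i\<close> and \<open>c $ i\<close> to vanish. The zero then spreads to all
  loads, giving \<open>c = 0\<close>.\<close>

lemma maximal_voltage_pos: "0 < V $ i"
proof (rule ccontr)
  have zero: "(A *v V) $ i = 0 \<and> c $ i = 0" if "V $ i = 0" for i
  proof -
    have "(A *v V) $ i \<le> 0" using that V_nonneg by (intro mult_nonpos)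
    moreover have "(A *v (diag a *v V)) $ i \<le> 0"
      using that V_nonneg a_nonneg by (intro mult_nonpos) auto
    moreover have "a $ i * (c $ i - (A *v V) $ i) \<le> (A *v (diag a *v V)) $ i"
      using maximal_grad_nonpos[of i] by (simp add: grad_def)
    ultimately have "c $ i - (A *v V) $ i \<le> 0"
      using maximal_weight_pos[of i] by (smt (verit) mult_pos_pos)
    then show ?thesis using \<open>(A *v V) $ i \<le> 0\<close> c_nonneg[of i] by linarith
  qed
  assume "\<not> 0 < V $ i"
  then have "V $ i = 0" using V_nonneg[of i] by simp
  then have "V $ j = 0" for j
    by (rule irreducible_induct[where P = "\<lambda>i. V $ i = 0"])
      (metis V_nonneg order_refl sum_neighbours_zero zero)
  then have "c = 0" using zero by (simp add: vec_eq_iff)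
  then show False using c_nonzero by simp
qed

lemma maximal_stationary:
  "(A *v (diag a *v V)) $ i = a $ i * (c $ i - (A *v V) $ i)"
proof -
  have "- grad a V i \<le> 0"
  proof (rule quadratic_nonpos_imp_linear_coeff_nonpos)
    show "0 < V $ i" by (rule maximal_voltage_pos)
    fix s assume s: "0 < s" "s < V $ i"
    show "s * - grad a V i - s * s * (a $ i * A $ i $ i) \<le> 0"
      using maximal[of "V + (- s) *s axis i 1"] V_nonneg s
      unfolding weighted_power_add_axis by (simp add: axis_def)
  qed
  then show ?thesis using maximal_grad_nonpos[of i] by (simp add: grad_def)
qed

end

section \<open>The supporting hyperplane on the ray through \<open>Q\<close>\<close>

text \<open>Pairing stationarity with \<open>V\<close> and using symmetry, the power equals the
  quadratic term, hence half the linear term. This is the source of the factor 1/2 in the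
  criterion.\<close>

lemma weighted_power_at_stationary:
  assumes "\<And>i. (A *v (diag a *v V)) $ i = a $ i * (c $ i - (A *v V) $ i)"
  shows "2 * (\<Sum>i\<in>UNIV. a $ i * load_power V i) = (diag a *v V) \<bullet> c"
proof -
  have "(\<Sum>i\<in>UNIV. a $ i * load_power V i) = V \<bullet> (A *v (diag a *v V))"
    unfolding inner_vec_def by (rule sum.cong) (simp_all add: assms load_power_def mult_ac)
  also have "\<dots> = (diag a *v V) \<bullet> (A *v V)" by (simp add: adjoint inner_commute)
  finally have "(\<Sum>i\<in>UNIV. a $ i * load_power V i) = (diag a *v V) \<bullet> (A *v V)" .
  moreover have "(\<Sum>i\<in>UNIV. a $ i * load_power V i) = (diag a *v V) \<bullet> c - (diag a *v V) \<bullet> (A *v V)"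
    unfolding inner_vec_def load_power_def
    by (simp add: sum_subtractf[symmetric] algebra_simps)
  ultimately show ?thesis by simp
qed

text \<open>The supporting point is taken on the ray through \<open>Q\<close>, not as a nearest point: then its power
  is at least \<open>t Q \<ge> 0\<close>, which gives \<open>A [a] V \<ge> 0\<close>.\<close>

lemma supporting_weight:
  assumes Q: "\<And>i. 0 \<le> Q $ i" and infeasible: "Q \<notin> dominated"
  obtains a V where "\<And>i. 0 < a $ i" "\<And>i. 0 < V $ i"
    "\<And>i. (A *v (diag a *v V)) $ i = a $ i * (c $ i - (A *v V) $ i)"
    "\<And>i. 0 \<le> (A *v (diag a *v V)) $ i"
    "(diag a *v V) \<bullet> c < 2 * (a \<bullet> Q)"
proof -
  obtain t V where t: "0 \<le> t" "t \<le> 1" and V: "\<And>i. 0 \<le> V $ i"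
    and sub: "\<And>i. t * Q $ i \<le> load_power V i"
    and ray: "\<And>s. t < s \<Longrightarrow> s \<le> 1 \<Longrightarrow> s *\<^sub>R Q \<notin> dominated"
    using dominated_ray_max[OF Q] by metis
  have tQ: "t *\<^sub>R Q \<in> dominated" using V sub by (auto simp: dominated_def)
  have t1: "t < 1" using t tQ infeasible by (cases "t = 1") auto
  \<comment> \<open>The end \<open>t\<close> is left out, so \<open>T\<close> is disjoint from
    \<open>dominated\<close>; the limit at \<open>t\<close> is taken in \<open>b\<close>.\<close>
  define T where "T = (\<lambda>s. s *\<^sub>R Q) ` {t<..1}"
  have "convex T"
    unfolding T_def by (intro convex_linear_image) (auto simp: linear_iff algebra_simps)
  moreover have "T \<noteq> {}" using t1 by (auto simp: T_def)
  moreover have "dominated \<inter> T = {}" using ray by (auto simp: T_def)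
  ultimately obtain a b where a0: "a \<noteq> 0" and below: "\<And>R. R \<in> dominated \<Longrightarrow> a \<bullet> R \<le> b"
    and above: "\<And>R. R \<in> T \<Longrightarrow> b \<le> a \<bullet> R"
    using separating_hyperplane_sets[OF convex_dominated, of T] tQ by blast
  have a: "0 \<le> a $ i" for i
  proof (rule ccontr)
    assume neg: "\<not> 0 \<le> a $ i"
    \<comment> \<open>Chosen so that \<open>s * a $ i = \<bar>b\<bar> + 1\<close> exceeds
      \<open>b\<close>, while the nonpositive demand \<open>s *s axis i 1\<close> is dominated by
      zero voltage.\<close>
    define s where "s = (\<bar>b\<bar> + 1) / a $ i"
    have "s \<le> 0" using neg by (simp add: s_def divide_nonneg_neg)
    then have "s *s axis i 1 \<in> dominated"
      by (auto simp: dominated_def axis_def load_power_def intro!: exI[of _ 0])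
    then have "a \<bullet> (s *s axis i 1) \<le> b" by (rule below)
    moreover have "a \<bullet> (s *s axis i 1) = s * a $ i"
      by (simp add: scalar_mult_eq_scaleR inner_axis)
    ultimately show False using neg by (simp add: s_def)
  qed
  have b: "b \<le> t * (a \<bullet> Q)"
  proof (rule tendsto_lowerbound[of "\<lambda>s. s * (a \<bullet> Q)" _ "at_right t"])
    show "((\<lambda>s. s * (a \<bullet> Q)) \<longlongrightarrow> t * (a \<bullet> Q)) (at_right t)" by (intro tendsto_intros)
    have "b \<le> s * (a \<bullet> Q)" if "t < s" "s \<le> 1" for s
    proof -
      have "s *\<^sub>R Q \<in> T" unfolding T_def using that by (intro imageI) simp
      from above[OF this] show ?thesis by simp
    qed
    then show "\<forall>\<^sub>F s in at_right t. b \<le> s * (a \<bullet> Q)"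
      unfolding eventually_at_right_field using t1 by (intro exI[of _ 1]) auto
  qed simp
  have weighted: "(\<Sum>i\<in>UNIV. a $ i * load_power W i) \<le> b" if "\<And>i. 0 \<le> W $ i" for W
  proof -
    have "(\<chi> i. load_power W i) \<in> dominated" using that by (auto simp: dominated_def)
    from below[OF this] show ?thesis by (simp add: inner_vec_def)
  qed
  have le: "a $ i * (t * Q $ i) \<le> a $ i * load_power V i" for i
    using a sub by (intro mult_left_mono)
  have taQ: "t * (a \<bullet> Q) = (\<Sum>i\<in>UNIV. a $ i * (t * Q $ i))"
    by (simp add: inner_vec_def sum_distrib_left mult_ac)
  also have "\<dots> \<le> (\<Sum>i\<in>UNIV. a $ i * load_power V i)" by (rule sum_mono) (rule le)
  \<comment> \<open>The chain from \<open>t * (a \<bullet> Q)\<close> through the power at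
    \<open>V\<close> to \<open>b\<close> closes up, so \<open>V\<close> attains the bound
    \<open>b\<close> and is a maximiser.\<close>
  finally have eqb: "(\<Sum>i\<in>UNIV. a $ i * load_power V i) = b" "t * (a \<bullet> Q) = b"
    using weighted[OF V] b by auto
  have maxi: "(\<Sum>i\<in>UNIV. a $ i * load_power W i) \<le> (\<Sum>i\<in>UNIV. a $ i * load_power V i)"
    if "\<And>i. 0 \<le> W $ i" for W
    using weighted[OF that] eqb by simp
  note supp = a a0 V maxi
  have apos: "0 < a $ i" for i by (rule maximal_weight_pos[OF supp])
  have Vpos: "0 < V $ i" for i by (rule maximal_voltage_pos[OF supp])
  have stat: "(A *v (diag a *v V)) $ i = a $ i * (c $ i - (A *v V) $ i)" for i
    by (rule maximal_stationary[OF supp])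
  have nonneg: "0 \<le> (A *v (diag a *v V)) $ i" for i
  proof -
    have "0 \<le> load_power V i" using t(1) Q[of i] sub[of i] by (meson mult_nonneg_nonneg order_trans)
    then show ?thesis
      using Vpos[of i] apos[of i] by (simp add: stat load_power_def zero_le_mult_iff)
  qed
  have "0 \<in> dominated" by (auto simp: dominated_def load_power_def intro!: exI[of _ 0])
  then have "Q \<noteq> 0" using infeasible by auto
  then obtain k where "Q $ k \<noteq> 0" by (auto simp: vec_eq_iff)
  then have "0 < a \<bullet> Q"
    unfolding inner_vec_def using Q[of k] apos Q
    by (intro sum_pos2[of _ k]) (auto intro: mult_pos_pos less_imp_le simp: order.order_iff_strict)
  then have "t * (a \<bullet> Q) < a \<bullet> Q" using t1 by simp
  then have "(diag a *v V) \<bullet> c < 2 * (a \<bullet> Q)"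
    using weighted_power_at_stationary[OF stat] eqb by simp
  then show thesis by (rule that[OF apos Vpos stat nonneg])
qed

section \<open>The matrix \<open>g(\<mu>)\<close> as a nonsingular M-matrix\<close>

lemma tangent_matrix_mult:
  "((diag \<mu> ** A + diag \<nu>) *v x) $ i = \<mu> $ i * (A *v x) $ i + \<nu> $ i * x $ i"
  by (simp add: matrix_vector_mult_add_rdistrib matrix_vector_mul_assoc[symmetric])

text \<open>Dividing row \<open>i\<close> by \<open>\<mu> $ i\<close> leaves \<open>A\<close> plus a
  nonnegative diagonal matrix.\<close>

lemma tangent_matrix_form:
  assumes "\<And>i. 0 < \<mu> $ i" "\<And>i. 0 \<le> \<nu> $ i"
  shows "x \<bullet> (A *v x) \<le> (\<Sum>i\<in>UNIV. x $ i / \<mu> $ i * ((diag \<mu> ** A + diag \<nu>) *v x) $ i)"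
  unfolding inner_vec_def
proof (rule sum_mono)
  fix i
  have "x $ i / \<mu> $ i * ((diag \<mu> ** A + diag \<nu>) *v x) $ i
      = x $ i * (A *v x) $ i + \<nu> $ i / \<mu> $ i * (x $ i * x $ i)"
    using assms(1)[of i] unfolding tangent_matrix_mult by (simp add: field_simps)
  then show "x $ i \<bullet> (A *v x) $ i \<le> x $ i / \<mu> $ i * ((diag \<mu> ** A + diag \<nu>) *v x) $ i"
    using assms(1)[of i] assms(2)[of i] by simp
qed

lemma tangent_matrix_invertible:
  assumes "\<And>i. 0 < \<mu> $ i" "\<And>i. 0 \<le> \<nu> $ i"
  shows "invertible (diag \<mu> ** A + diag \<nu>)"
proof (rule invertible_if_trivial_kernel)
  fix x assume "(diag \<mu> ** A + diag \<nu>) *v x = 0"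
  then have "x \<bullet> (A *v x) \<le> 0" using tangent_matrix_form[OF assms, of x] by simp
  then show "x = 0" using posdef[of x] by force
qed

text \<open>\<open>[\<mu>]\<inverse> ([\<mu>] A + [\<nu>])\<close> is symmetric and positive semidefinite; apply its form to the real and
  imaginary parts of an eigenvector.\<close>

lemma tangent_matrix_M_matrix:
  assumes \<mu>: "\<And>i. 0 < \<mu> $ i" and \<nu>: "\<And>i. 0 \<le> \<nu> $ i"
  shows "M_matrix (diag \<mu> ** A + diag \<nu>)"
  unfolding M_matrix_def
proof (intro conjI allI impI)
  fix i j :: 'n assume "i \<noteq> j"
  have "(diag \<mu> ** A) $ i $ j = (\<Sum>k\<in>UNIV. if i = k then \<mu> $ i * A $ k $ j else 0)"
    unfolding matrix_matrix_mult_def by (simp only: vec_lambda_beta, rule sum.cong) (auto simp: diag_def)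
  then show "(diag \<mu> ** A + diag \<nu>) $ i $ j \<le> 0"
    using \<open>i \<noteq> j\<close> \<mu>[of i] offdiag[of i j] by (simp add: diag_def mult_le_0_iff)
next
  fix l
  define G where "G = diag \<mu> ** A + diag \<nu>"
  assume "eigenvalue_of (diag \<mu> ** A + diag \<nu>) l"
  then obtain v where v: "v \<noteq> 0" and ev: "map_matrix complex_of_real G *v v = l *s v"
    unfolding eigenvalue_of_def G_def by blast
  define x :: "real ^ 'n" where "x = (\<chi> i. Re (v $ i))"
  define y :: "real ^ 'n" where "y = (\<chi> i. Im (v $ i))"
  have ev': "(\<Sum>j\<in>UNIV. complex_of_real (G $ i $ j) * v $ j) = l * v $ i" for i
    using arg_cong[OF ev, of "\<lambda>w. w $ i"] by (simp add: matrix_vector_mult_def map_matrix_def)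
  have Gx: "(G *v x) $ i = Re l * x $ i - Im l * y $ i" for i
    using arg_cong[OF ev', of Re] by (simp add: matrix_vector_component x_def y_def)
  have Gy: "(G *v y) $ i = Re l * y $ i + Im l * x $ i" for i
    using arg_cong[OF ev', of Im] by (simp add: matrix_vector_component x_def y_def)
  have "0 \<le> (\<Sum>i\<in>UNIV. x $ i / \<mu> $ i * (G *v x) $ i) + (\<Sum>i\<in>UNIV. y $ i / \<mu> $ i * (G *v y) $ i)"
    using tangent_matrix_form[OF \<mu> \<nu>, of x] tangent_matrix_form[OF \<mu> \<nu>, of y]
      possemidef[of x] possemidef[of y] unfolding G_def by linarith
  \<comment> \<open>The cross terms with \<open>Im l\<close> cancel between the two sums.\<close>
  also have "\<dots> = Re l * (\<Sum>i\<in>UNIV. (x $ i * x $ i + y $ i * y $ i) / \<mu> $ i)"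
    unfolding Gx Gy sum.distrib[symmetric] sum_distrib_left
    by (rule sum.cong) (simp_all add: diff_divide_distrib add_divide_distrib algebra_simps)
  finally have le: "0 \<le> Re l * (\<Sum>i\<in>UNIV. (x $ i * x $ i + y $ i * y $ i) / \<mu> $ i)" .
  obtain k where "v $ k \<noteq> 0" using v by (auto simp: vec_eq_iff)
  then have "0 < x $ k * x $ k + y $ k * y $ k"
    by (simp add: x_def y_def complex_eq_iff sum_squares_gt_zero_iff)
  then have "0 < (\<Sum>i\<in>UNIV. (x $ i * x $ i + y $ i * y $ i) / \<mu> $ i)"
    by (intro sum_pos2[of _ k]) (use \<mu> in \<open>auto intro!: divide_pos_pos divide_nonneg_pos\<close>)
  then show "0 \<le> Re l" using le by (simp add: zero_le_mult_iff)
qed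

end

section \<open>From the Kirchhoff matrix to the locale\<close>

text \<open>The Dirichlet energy, obtained by averaging the form with its copy under exchange of
  \<open>i\<close> and \<open>j\<close>.\<close>

lemma laplacian_form:
  assumes "weighted_graph w"
  shows "2 * (z \<bullet> (laplacian w *v z)) = (\<Sum>i\<in>UNIV. \<Sum>j\<in>UNIV. w i j * (z $ i - z $ j)\<^sup>2)"
proof -
  have wsym: "w i j = w j i" and wdiag: "w i i = 0" for i j
    using assms unfolding weighted_graph_def by auto
  have L: "(laplacian w *v z) $ i = (\<Sum>j\<in>UNIV. w i j * (z $ i - z $ j))" for i
  proof -
    have "(laplacian w *v z) $ i
        = (\<Sum>j\<in>UNIV. (if i = j then (\<Sum>k\<in>UNIV. w i k) * z $ i else 0) - w i j * z $ j)"
      unfolding matrix_vector_component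
      by (rule sum.cong) (auto simp: laplacian_def wdiag)
    then show ?thesis by (simp add: sum_subtractf sum_distrib_right right_diff_distrib)
  qed
  have S1: "z \<bullet> (laplacian w *v z) = (\<Sum>i\<in>UNIV. \<Sum>j\<in>UNIV. w i j * (z $ i * (z $ i - z $ j)))"
    by (simp add: inner_vec_def L sum_distrib_left mult_ac)
  also have "\<dots> = (\<Sum>i\<in>UNIV. \<Sum>j\<in>UNIV. w i j * (z $ j * (z $ j - z $ i)))"
    by (subst sum.swap) (simp add: wsym)
  finally have S2: "z \<bullet> (laplacian w *v z)
    = (\<Sum>i\<in>UNIV. \<Sum>j\<in>UNIV. w i j * (z $ j * (z $ j - z $ i)))" .
  have "2 * (z \<bullet> (laplacian w *v z)) = (\<Sum>i\<in>UNIV. \<Sum>j\<in>UNIV. w i j * (z $ i * (z $ i - z $ j)))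
      + (\<Sum>i\<in>UNIV. \<Sum>j\<in>UNIV. w i j * (z $ j * (z $ j - z $ i)))"
    using S1 S2 by linarith
  then show ?thesis
    by (simp add: sum.distrib[symmetric] power2_eq_square algebra_simps)
qed

lemma laplacian_form_zero_imp_constant:
  assumes "weighted_graph w" "connected_graph w" "z \<bullet> (laplacian w *v z) \<le> 0"
  shows "z $ i = z $ j"
proof -
  have wnn: "0 \<le> w i j" for i j using assms(1) unfolding weighted_graph_def by auto
  have nn: "0 \<le> (\<Sum>j\<in>UNIV. w i j * (z $ i - z $ j)\<^sup>2)" for i by (intro sum_nonneg) (simp add: wnn)
  have "(\<Sum>i\<in>UNIV. \<Sum>j\<in>UNIV. w i j * (z $ i - z $ j)\<^sup>2) = 0"
    using laplacian_form[OF assms(1), of z] assms(3)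
    by (intro order_antisym sum_nonneg[OF nn]) simp
  then have "w i j * (z $ i - z $ j)\<^sup>2 = 0" for i j
    using nn by (simp add: sum_nonneg_eq_0_iff wnn)
  then have edge: "z $ i = z $ j" if "0 < w i j" for i j
    using that by (metis less_irrefl mult_eq_0_iff power2_eq_square right_minus_eq)
  have "(i, j) \<in> {(k, l). 0 < w k l}\<^sup>*" using assms(2) by (simp add: connected_graph_def)
  then show ?thesis by (induction rule: rtrancl_induct) (auto dest: edge)
qed

lemma sum_UNIV_Plus:
  fixes f :: "'a::finite + 'b::finite \<Rightarrow> 'c::comm_monoid_add"
  shows "sum f UNIV = (\<Sum>i\<in>UNIV. f (Inl i)) + (\<Sum>k\<in>UNIV. f (Inr k))"
  by (simp add: UNIV_Plus_UNIV[symmetric] sum.Plus del: UNIV_Plus_UNIV)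

lemma power_grid_Y_LL:
  fixes Y :: "real ^ ('n::finite + 'm::finite) ^ ('n + 'm)" and V\<^sub>S :: "real ^ 'm"
  assumes "kirchhoff Y" "irreducible_matrix (Y_LL Y)" and VS: "\<forall>k. V\<^sub>S $ k > 0"
  shows "power_grid (Y_LL Y) (I_star Y V\<^sub>S)"
proof -
  obtain w where w: "weighted_graph w" and conn: "connected_graph w" and Y: "Y = laplacian w"
    using assms(1) unfolding kirchhoff_def by blast
  have wsym: "w i j = w j i" and wnn: "0 \<le> w i j" for i j
    using w unfolding weighted_graph_def by auto
  have I: "I_star Y V\<^sub>S $ i = (\<Sum>k\<in>UNIV. w (Inl i) (Inr k) * V\<^sub>S $ k)" for i
    by (simp add: I_star_def matrix_vector_component Y_LS_def Y laplacian_def sum_negf)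
  have wV: "0 \<le> w i (Inr k) * V\<^sub>S $ k" for i k
    using VS wnn by (simp add: less_imp_le)
  have I_nonneg: "0 \<le> I_star Y V\<^sub>S $ i" for i
    unfolding I by (rule sum_nonneg) (rule wV)
  show ?thesis
  proof
    show "Y_LL Y $ i $ j = Y_LL Y $ j $ i" for i j by (simp add: Y_LL_def Y laplacian_def wsym)
    show "Y_LL Y $ i $ j \<le> 0" if "i \<noteq> j" for i j
      using that by (simp add: Y_LL_def Y laplacian_def wnn)
    show "irreducible_matrix (Y_LL Y)" by fact
    show "0 \<le> I_star Y V\<^sub>S $ i" for i by (rule I_nonneg)
  next
    fix x :: "real ^ 'n" assume "x \<noteq> 0"
    \<comment> \<open>Extending \<open>x\<close> by 0 to the sources turns its form into a Dirichlet
      energy; if that vanished, \<open>z\<close> would be constant, equal to its value 0 at any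
      source.\<close>
    define z :: "real ^ ('n + 'm)" where "z = (\<chi> v. case v of Inl i \<Rightarrow> x $ i | Inr k \<Rightarrow> 0)"
    have "x \<bullet> (Y_LL Y *v x) = z \<bullet> (laplacian w *v z)"
      by (simp add: inner_vec_def matrix_vector_component sum_UNIV_Plus z_def Y_LL_def Y)
    moreover have "\<not> z \<bullet> (laplacian w *v z) \<le> 0"
    proof
      assume "z \<bullet> (laplacian w *v z) \<le> 0"
      from laplacian_form_zero_imp_constant[OF w conn this, of "Inl _" "Inr undefined"]
      have "x $ i = 0" for i by (simp add: z_def)
      then show False using \<open>x \<noteq> 0\<close> by (simp add: vec_eq_iff)
    qed
    ultimately show "0 < x \<bullet> (Y_LL Y *v x)" by simp
  next
    show "I_star Y V\<^sub>S \<noteq> 0"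
    proof
      assume "I_star Y V\<^sub>S = 0"
      then have "(\<Sum>k\<in>UNIV. w (Inl i) (Inr k) * V\<^sub>S $ k) = 0" for i using I[of i] by simp
      then have "w (Inl i) (Inr k) * V\<^sub>S $ k = 0" for i k
        by (simp only: sum_nonneg_eq_0_iff[OF finite wV] UNIV_I ball_UNIV)
      then have "w (Inl i) (Inr k) = 0" for i k
        using VS by (metis less_irrefl mult_eq_0_iff)
      \<comment> \<open>Without load-source edges, no path from a load reaches a source, against
        connectedness.\<close>
      then have no_edge: "\<exists>i'. v = Inl i'" if "0 < w (Inl i) v" for i v
        using that by (cases v) auto
      have "(Inl undefined, Inr undefined) \<in> {(k, l). 0 < w k l}\<^sup>*"
        using conn by (simp add: connected_graph_def)
      then have "\<exists>i. Inr undefined = (Inl i :: 'n + 'm)"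
        by (induction rule: rtrancl_induct) (auto dest: no_edge)
      then show False by simp
    qed
  qed
qed

section \<open>Feasibility from the half-space conditions\<close>

theorem corollary4p3:
  fixes Y :: "real ^ ('n::finite + 'm::finite) ^ ('n + 'm)"
    and V\<^sub>S :: "real ^ 'm"
    and P :: "real ^ 'n"
  assumes "kirchhoff Y"
    and "irreducible_matrix (Y_LL Y)"
    and "\<forall>k. V\<^sub>S $ k > 0"
    and "\<forall>\<nu>\<in>N1_set. \<chi>_fun Y V\<^sub>S \<nu> \<bullet> vmax P 0 \<le> 1 / 2 * (\<nu> \<bullet> V_star Y V\<^sub>S)"
  shows "P \<in> feasible_demands Y V\<^sub>S"
proof -
  interpret power_grid "Y_LL Y" "I_star Y V\<^sub>S" by (rule power_grid_Y_LL[OF assms(1-3)])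
  define A where "A = Y_LL Y"
  define c where "c = I_star Y V\<^sub>S"
  have Vstar: "V_star Y V\<^sub>S = Vopen" by (simp add: V_star_def Vopen_def)
  define Q where "Q = vmax P 0"
  have Q: "0 \<le> Q $ i" "P $ i \<le> Q $ i" for i by (simp_all add: Q_def vmax_def)
  have "Q \<in> dominated"
  proof (rule ccontr)
    assume "Q \<notin> dominated"
    then obtain a V where a: "\<And>i. 0 < a $ i" and V: "\<And>i. 0 < V $ i"
      and stat: "\<And>i. (A *v (diag a *v V)) $ i = a $ i * (c $ i - (A *v V) $ i)"
      and nonneg: "\<And>i. 0 \<le> (A *v (diag a *v V)) $ i"
      and less: "(diag a *v V) \<bullet> c < 2 * (a \<bullet> Q)"
      using supporting_weight[OF Q(1)] unfolding A_def c_def by metis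
    \<comment> \<open>The scaling that puts \<open>\<nu>\<close> into \<open>N1_set\<close>.\<close>
    define r where "r = (\<Sum>i\<in>UNIV. (A *v (diag a *v V)) $ i)"
    have "diag a *v V \<noteq> 0" using a V by (metis diag_mult_component less_irrefl mult_pos_pos zero_index)
    then have "A *v (diag a *v V) \<noteq> 0" using posdef unfolding A_def by (metis inner_zero_right less_irrefl)
    then have r: "0 < r"
      unfolding r_def using nonneg
      by (metis (no_types, lifting) UNIV_I finite order.order_iff_strict sum_nonneg sum_nonneg_0
          vec_eq_iff zero_index)
    define \<mu> where "\<mu> = (1 / r) *s (diag a *v V)"
    define \<nu> where "\<nu> = A *v \<mu>"
    have \<mu>_pos: "0 < \<mu> $ i" for i using a V r by (simp add: \<mu>_def)
    have \<nu>_eq: "\<nu> = (1 / r) *s (A *v (diag a *v V))" by (simp add: \<nu>_def \<mu>_def vector_scalar_commute)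
    have \<nu>_nonneg: "0 \<le> \<nu> $ i" for i using nonneg[of i] r by (simp add: \<nu>_eq)
    have "(\<Sum>i\<in>UNIV. \<nu> $ i) = 1"
      using r by (simp add: \<nu>_eq sum_divide_distrib[symmetric] r_def[symmetric])
    then have \<nu>1: "\<nu> \<in> N1_set" using \<nu>_nonneg by (simp add: N1_set_def N_set_def)
    have inv\<nu>: "matrix_inv (Y_LL Y) *v \<nu> = \<mu>"
      by (rule matrix_inv_mult_eq[OF invertible_A]) (simp add: \<nu>_def A_def)
    have g: "g_mat Y \<mu> = diag \<mu> ** Y_LL Y + diag \<nu>" by (simp add: g_mat_def \<nu>_def A_def)
    have g_good: "invertible (g_mat Y \<mu>)" "M_matrix (g_mat Y \<mu>)"
      unfolding g using tangent_matrix_invertible[OF \<mu>_pos \<nu>_nonneg]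
        tangent_matrix_M_matrix[OF \<mu>_pos \<nu>_nonneg] by auto
    \<comment> \<open>By stationarity \<open>r *s \<nu>\<close> is \<open>[a] (c - A V)\<close>, so
      the terms with \<open>A *v V\<close> cancel.\<close>
    have "g_mat Y \<mu> *v V = diag \<mu> *v c"
      unfolding g vec_eq_iff
      using r by (simp add: tangent_matrix_mult \<nu>_eq stat) (simp add: \<mu>_def A_def field_simps)
    then have \<psi>: "\<psi> Y V\<^sub>S \<mu> = V"
      using g_good matrix_inv_mult_eq[OF g_good(1), of V] by (simp add: \<psi>_def c_def)
    have "invertible (diag V)"
    proof (rule invertible_if_trivial_kernel)
      fix x assume "diag V *v x = 0"
      then show "x = 0" using V by (metis diag_mult_component less_irrefl mult_eq_0_iff vec_eq_iff zero_index)
    qed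
    then have \<chi>: "\<chi>_fun Y V\<^sub>S \<nu> = (1 / r) *s a"
      unfolding \<chi>_fun_def inv\<nu> \<psi>
      by (rule matrix_inv_mult_eq) (simp add: vec_eq_iff \<mu>_def)
    have "\<chi>_fun Y V\<^sub>S \<nu> \<bullet> Q \<le> 1 / 2 * (\<nu> \<bullet> Vopen)"
      using assms(4) \<nu>1 unfolding Q_def Vstar by blast
    \<comment> \<open>Symmetry moves \<open>A\<close> onto \<open>Vopen\<close>; after scaling by
      \<open>r\<close> the hypothesis at \<open>\<nu>\<close> is the reverse of
      \<open>less\<close>.\<close>
    moreover have "\<nu> \<bullet> Vopen = \<mu> \<bullet> c"
      unfolding \<nu>_def A_def c_def adjoint[symmetric] mult_Vopen ..
    ultimately have "(1 / r) * (2 * (a \<bullet> Q)) \<le> (1 / r) * ((diag a *v V) \<bullet> c)"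
      unfolding \<chi> \<mu>_def by (simp add: scalar_mult_eq_scaleR)
    then show False using less r by (simp add: divide_le_cancel)
  qed
  then obtain V where "\<And>i. 0 \<le> V $ i" "\<And>i. Q $ i \<le> load_power V i"
    by (auto simp: dominated_def)
  with Q(1) obtain W where W: "\<And>i. 0 < W $ i" "\<And>i. Q $ i \<le> load_power W i"
    using make_subsolution_positive by metis
  then have "P $ i \<le> load_power W i" for i using Q(2) order_trans by blast
  then obtain U where U: "\<And>i. 0 < U $ i" "\<And>i. load_power U i = P $ i"
    using solution_above_subsolution[OF W(1)] by metis
  have "P = P_c Y V\<^sub>S U"
    using U(2) unfolding load_power_def right_diff_distrib
    by (simp add: vec_eq_iff P_c_def Vstar matrix_vector_mult_diff_distrib mult_Vopen)
  then show ?thesis using U(1) by (auto simp: feasible_demands_def)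
qed

end
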